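(* Let $A\in\mathbb{R}_{\max}^{m\times n}$ and $z\in\mathbb{R}_{\max}^n$ be such that every row and every column of $A$ has at least one finite entry and all components of $A\boxplus z$ are finite. Let $x^*$ be an optimal solution of the problem $$\text{minimize } |\operatorname{supp}(x)| \text{ over } x\in\mathbb{R}_{\max}^n \text{ subject to } A\boxplus x=A\boxplus z.$$ Then $x^*=z$ if the following sufficient condition holds: for every $j\in\operatorname{supp}(z)$ there exists a row index $i=i(j)\in I$ such that (a) for all other indices in the support, $k\in\operatorname{supp}(z)$, $k\ne j$, we have $$A_{ij}>A_{ik}+z_k-z_j;$$ (b) for all indices in the complement of the support, $l\in J\setminus\operatorname{supp}(z)$, there exists at least one row index $s=s(j,l)\in I$ such that $$A_{sl}>A_{il}+[A\boxplus z]_s-[A\boxplus z]_i .$$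
   Context: $I=\{1,\dots,m\}$, $J=\{1,\dots,n\}$. $\mathbb{R}_{\max}=\mathbb{R}\cup\{-\infty\}$ with $a+(-\infty)=-\infty$. For $x\in\mathbb{R}_{\max}^n$: $[A\boxplus x]_i=\max_{j\in J}(A_{ij}+x_j)$ for $i\in I$, and $\operatorname{supp}(x)=\{j\in J:x_j\ne-\infty\}$. *)

theory Defs
  imports "HOL-Analysis.Finite_Cartesian_Product" "HOL-Library.Extended_Real"
begin

text \<open>
  The max-plus semiring is represented inside \<^typ>\<open>ereal\<close> by excluding \<open>\<infinity>\<close>; on this
  subset \<^typ>\<open>ereal\<close> addition satisfies \<open>a + (-\<infinity>) = -\<infinity>\<close>.
\<close>

definition Rmax :: "ereal set" where
  "Rmax = {a. a \<noteq> \<infinity>}"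

definition Rmax_vec :: "(ereal ^ 'n) set" where
  "Rmax_vec = {x. \<forall>j. x $ j \<in> Rmax}"

definition Rmax_mat :: "(ereal ^ 'n ^ 'm) set" where
  "Rmax_mat = {A. \<forall>i j. A $ i $ j \<in> Rmax}"

definition mp_mult :: "ereal ^ 'n ^ 'm \<Rightarrow> ereal ^ 'n \<Rightarrow> ereal ^ 'm"  (infixl "\<boxplus>" 70) where
  "A \<boxplus> x = (\<chi> i. Max (range (\<lambda>j. A $ i $ j + x $ j)))"

definition supp :: "ereal ^ 'n \<Rightarrow> 'n set" where
  "supp x = {j. x $ j \<noteq> -\<infinity>}"

definition sparsest_solution :: "ereal ^ 'n ^ 'm \<Rightarrow> ereal ^ 'm \<Rightarrow> ereal ^ 'n \<Rightarrow> bool" where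
  "sparsest_solution A b x \<longleftrightarrow>
     is_arg_min (\<lambda>y. card (supp y)) (\<lambda>y. y \<in> Rmax_vec \<and> A \<boxplus> y = b) x"

end

theory Submission
  imports Defs
begin

text \<open>
  Write \<open>b = A \<boxplus> z\<close>. Every solution \<open>x\<close> of \<open>A \<boxplus> x = b\<close> turns out to agree with \<open>z\<close> on
  the support of \<open>z\<close>, so that \<open>supp z \<subseteq> supp x\<close>; since \<open>z\<close> is itself a solution,
  a sparsest solution can have no further finite entries and must be \<open>z\<close>.

  The agreement on \<open>supp z\<close> is read off from the certifying rows. By (a), in the row \<open>i(j)\<close> the
  maximum defining \<open>b\<close> is attained by \<open>z\<close> at the column \<open>j\<close> and at no other
  (\<open>strictly_dominant_column\<close>). Hence no solution can exceed \<open>z\<close> at any \<open>j\<close> in \<open>supp z\<close>. For a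
  solution \<open>x\<close>, the maximum in row \<open>i(j)\<close> is attained somewhere, say at column \<open>p\<close>. If \<open>p\<close> lay
  outside \<open>supp z\<close>, then by (b) the same entry \<open>x\<^sub>p\<close> would overshoot \<open>b\<close> in row \<open>s(j,p)\<close>
  (\<open>no_attainment_if_overshoot\<close>). If \<open>p\<close> lay in \<open>supp z\<close> but differed from \<open>j\<close>, reaching \<open>b\<close>
  there would require \<open>x\<^sub>p > z\<^sub>p\<close>, which was just excluded. So \<open>p = j\<close>, and cancelling
  \<open>A\<^sub>i\<^sub>j\<close> yields \<open>x\<^sub>j = z\<^sub>j\<close>.
\<close>

lemma mp_mult_upper: "A $ i $ j + x $ j \<le> (A \<boxplus> x) $ i"
  by (simp add: mp_mult_def)

lemma mp_mult_attained: "\<exists>j. (A \<boxplus> x) $ i = A $ i $ j + x $ j"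
proof -
  have "(A \<boxplus> x) $ i \<in> range (\<lambda>j. A $ i $ j + x $ j)"
    unfolding mp_mult_def by (simp only: vec_lambda_beta) (rule Max_in, auto)
  then show ?thesis
    by auto
qed

text \<open>
  Columns outside \<open>supp z\<close> contribute \<open>-\<infinity>\<close>, so they lose against \<open>j\<close> in row \<open>i\<close> because
  \<open>(A \<boxplus> z)\<^sub>i\<close> is finite; the domination hypothesis takes care of the columns in \<open>supp z\<close>.
\<close>

lemma strictly_dominant_column:
  assumes A: "A \<in> Rmax_mat" and z: "z \<in> Rmax_vec"
    and fin: "\<bar>(A \<boxplus> z) $ i\<bar> \<noteq> \<infinity>"
    and j: "j \<in> supp z"
    and dom: "\<forall>k\<in>supp z. k \<noteq> j \<longrightarrow> A $ i $ j > A $ i $ k + z $ k - z $ j"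
  shows "(A \<boxplus> z) $ i = A $ i $ j + z $ j"
    and "\<And>k. k \<noteq> j \<Longrightarrow> A $ i $ k + z $ k < A $ i $ j + z $ j"
proof -
  have notinf: "A $ i $ k \<noteq> \<infinity>" "z $ k \<noteq> \<infinity>" for k
    using A z by (auto simp: Rmax_mat_def Rmax_vec_def Rmax_def)
  have zj: "z $ j \<noteq> -\<infinity>"
    using j by (simp add: supp_def)
  have on_supp: "A $ i $ k + z $ k < A $ i $ j + z $ j" if "k \<in> supp z" "k \<noteq> j" for k
  proof -
    obtain r where r: "z $ j = ereal r"
      using zj notinf[of j] by (cases "z $ j") auto
    have "A $ i $ k + z $ k - ereal r < A $ i $ j"
      using dom that r by auto
    then show ?thesis
      by (simp add: r ereal_minus_less)
  qed
  have off_supp: "A $ i $ k + z $ k = -\<infinity>" if "k \<notin> supp z" for k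
    using that notinf[of k] by (simp add: supp_def)
  have not_bot: "(A \<boxplus> z) $ i \<noteq> -\<infinity>"
    using fin by auto
  obtain p where p: "(A \<boxplus> z) $ i = A $ i $ p + z $ p"
    using mp_mult_attained by blast
  have "p = j"
  proof (rule ccontr)
    assume "p \<noteq> j"
    moreover have "p \<in> supp z"
      using off_supp p not_bot by metis
    ultimately have "A $ i $ p + z $ p < A $ i $ j + z $ j"
      by (rule on_supp[rotated])
    with mp_mult_upper[of A i j z] p show False
      by simp
  qed
  with p show attained: "(A \<boxplus> z) $ i = A $ i $ j + z $ j"
    by simp
  show "A $ i $ k + z $ k < A $ i $ j + z $ j" if "k \<noteq> j" for k
    using on_supp off_supp that attained not_bot
    by (metis ereal_infty_less(2))
qed

text \<open>
  If \<open>x\<close> attained \<open>b\<^sub>i\<close> at the column \<open>l\<close>, its entry there would be \<open>b\<^sub>i - A\<^sub>i\<^sub>l\<close>; the hypothesis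
  on the row \<open>s\<close> says precisely that this value is too large for the row \<open>s\<close>.
\<close>

lemma no_attainment_if_overshoot:
  assumes fin: "\<bar>(A \<boxplus> x) $ i\<bar> \<noteq> \<infinity>" "\<bar>(A \<boxplus> x) $ s\<bar> \<noteq> \<infinity>"
    and overshoot: "A $ s $ l > A $ i $ l + (A \<boxplus> x) $ s - (A \<boxplus> x) $ i"
  shows "(A \<boxplus> x) $ i \<noteq> A $ i $ l + x $ l"
proof
  assume att: "(A \<boxplus> x) $ i = A $ i $ l + x $ l"
  have "A $ s $ l + x $ l > (A \<boxplus> x) $ s"
  proof -
    obtain a r t where reals: "A $ i $ l = ereal a" "x $ l = ereal r" "(A \<boxplus> x) $ s = ereal t"
      using fin unfolding att
      by (cases "A $ i $ l"; cases "x $ l"; cases "(A \<boxplus> x) $ s") auto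
    have "A $ s $ l > ereal (t - r)"
      using overshoot unfolding att reals by simp
    then show ?thesis
      unfolding reals by (cases "A $ s $ l") auto
  qed
  with mp_mult_upper[of A s l x] show False
    by simp
qed

text \<open>
  Optimality matters only for counting finite entries, so the argument about certifying rows
  is made for an arbitrary solution. The bound \<open>x \<le> z\<close> must be available on all of \<open>supp z\<close>
  before any single equality: it is what rules out that another column of \<open>supp z\<close> takes over the
  certifying row of \<open>j\<close>.
\<close>

lemma solution_eq_on_supp:
  fixes A :: "ereal ^ 'n ^ 'm" and z x :: "ereal ^ 'n"
  assumes A: "A \<in> Rmax_mat" and z: "z \<in> Rmax_vec"
    and fin: "\<And>i. \<bar>(A \<boxplus> z) $ i\<bar> \<noteq> \<infinity>"
    and cond: "\<And>j. j \<in> supp z \<Longrightarrow>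
      \<exists>i. (\<forall>k\<in>supp z. k \<noteq> j \<longrightarrow> A $ i $ j > A $ i $ k + z $ k - z $ j) \<and>
          (\<forall>l\<in>- supp z. \<exists>s. A $ s $ l > A $ i $ l + (A \<boxplus> z) $ s - (A \<boxplus> z) $ i)"
    and sol: "A \<boxplus> x = A \<boxplus> z"
    and j: "j \<in> supp z"
  shows "x $ j = z $ j"
proof -
  have upper: "x $ k \<le> z $ k" if k: "k \<in> supp z" for k
  proof -
    obtain i where "\<forall>k'\<in>supp z. k' \<noteq> k \<longrightarrow> A $ i $ k > A $ i $ k' + z $ k' - z $ k"
      using cond[OF k] by blast
    then have att: "(A \<boxplus> z) $ i = A $ i $ k + z $ k"
      using strictly_dominant_column(1)[OF A z fin k] by blast
    have "A $ i $ k + x $ k \<le> A $ i $ k + z $ k"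
      using mp_mult_upper[of A i k x] by (simp add: sol att)
    then show ?thesis
      using fin[of i] unfolding att
      by (cases "A $ i $ k"; cases "x $ k"; cases "z $ k") auto
  qed
  obtain i where a: "\<forall>k\<in>supp z. k \<noteq> j \<longrightarrow> A $ i $ j > A $ i $ k + z $ k - z $ j"
    and b: "\<forall>l\<in>- supp z. \<exists>s. A $ s $ l > A $ i $ l + (A \<boxplus> z) $ s - (A \<boxplus> z) $ i"
    using cond[OF j] by blast
  note dominant = strictly_dominant_column[OF A z fin j a]
  obtain p where p: "(A \<boxplus> x) $ i = A $ i $ p + x $ p"
    using mp_mult_attained by blast
  have "p \<in> supp z"
  proof (rule ccontr)
    assume "p \<notin> supp z"
    then obtain s where "A $ s $ p > A $ i $ p + (A \<boxplus> x) $ s - (A \<boxplus> x) $ i"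
      using b sol by auto
    then have "(A \<boxplus> x) $ i \<noteq> A $ i $ p + x $ p"
      by (intro no_attainment_if_overshoot) (simp_all only: sol fin not_False_eq_True)
    with p show False
      by simp
  qed
  then have "(A \<boxplus> z) $ i \<le> A $ i $ p + z $ p"
    using upper p sol by (simp add: add_left_mono)
  then have "p = j"
    using dominant(1) dominant(2)[of p] by (metis leD)
  then have "A $ i $ j + x $ j = A $ i $ j + z $ j"
    using p sol dominant(1) by simp
  then show ?thesis
    using fin[of i] unfolding dominant(1)
    by (cases "A $ i $ j"; cases "x $ j"; cases "z $ j") auto
qed

theorem theorem6:
  fixes A :: "ereal ^ 'n ^ 'm" and z xstar :: "ereal ^ 'n"
  assumes A: "A \<in> Rmax_mat" and z: "z \<in> Rmax_vec"
    and rows: "\<And>i. \<exists>j. \<bar>A $ i $ j\<bar> \<noteq> \<infinity>"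
    and cols: "\<And>j. \<exists>i. \<bar>A $ i $ j\<bar> \<noteq> \<infinity>"
    and finite_Az: "\<And>i. \<bar>(A \<boxplus> z) $ i\<bar> \<noteq> \<infinity>"
    and opt: "sparsest_solution A (A \<boxplus> z) xstar"
    and cond: "\<And>j. j \<in> supp z \<Longrightarrow>
      \<exists>i. (\<forall>k\<in>supp z. k \<noteq> j \<longrightarrow> A $ i $ j > A $ i $ k + z $ k - z $ j) \<and>
          (\<forall>l\<in>- supp z. \<exists>s. A $ s $ l > A $ i $ l + (A \<boxplus> z) $ s - (A \<boxplus> z) $ i)"
  shows "xstar = z"
proof -
  have sol: "A \<boxplus> xstar = A \<boxplus> z"
    and minimal: "card (supp xstar) \<le> card (supp z)"
    using opt z by (auto simp: sparsest_solution_def is_arg_min_linorder)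
  have agree: "xstar $ j = z $ j" if "j \<in> supp z" for j
    using solution_eq_on_supp[OF A z finite_Az cond sol that] .
  then have "supp z \<subseteq> supp xstar"
    by (auto simp: supp_def)
  with minimal have same_supp: "supp z = supp xstar"
    by (intro card_seteq) auto
  have "xstar $ j = z $ j" for j
  proof (cases "j \<in> supp z")
    case True
    then show ?thesis by (rule agree)
  next
    case False
    then have "j \<notin> supp xstar" by (simp only: same_supp not_False_eq_True)
    with False show ?thesis by (simp add: supp_def)
  qed
  then show ?thesis
    by (simp add: vec_eq_iff)
qed

end
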